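(* Let $N\ge 1$, let $[N]=\{1,\dots,N\}$ be partitioned into $M$ disjoint nonempty groups $\mathcal G_1,\dots,\mathcal G_M$, and let $a,b\in\mathbb R$. Let $K=(\kappa_{ij})\in\mathbb R^{N\times N}$ be given by $\kappa_{ij}=a$ if $i,j$ belong to the same group (including $i=j$) and $\kappa_{ij}=b$ if $i,j$ belong to different groups. Let $D_K$ be the diagonal matrix with $(D_K)_{ii}=\sum_{j=1}^N\kappa_{ij}$, and let $L=D_K-K$. Then the eigenvalues of $L$, listed with multiplicity, are: \begin{itemize} \item $\lambda=a|\mathcal G_m|+b\,(N-|\mathcal G_m|)$ with multiplicity $|\mathcal G_m|-1$, for each $m=1,\dots,M$; \item $\lambda=0$ with multiplicity $1$; \item $\lambda=bN$ with multiplicity $M-1$. \end{itemize}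
   Context: The list describes the full spectrum of $L$ as a multiset of $N$ numbers: if values from different lines coincide (for instance when $b=0$), their multiplicities add up. An entry with multiplicity $0$ is absent. *)

theory Defs
  imports
    "Jordan_Normal_Form.Char_Poly"
    "HOL-Library.Disjoint_Sets"
    "HOL-Library.Multiset"
begin

(* Matrix indices start at 0, so the index set [N] is {..<N} throughout. *)

definition group_kernel :: "nat \<Rightarrow> (nat \<Rightarrow> nat set) \<Rightarrow> nat \<Rightarrow> real \<Rightarrow> real \<Rightarrow> real mat" where
  "group_kernel M G N a b =
     mat N N (\<lambda>(i, j). if \<exists>m\<in>{1..M}. i \<in> G m \<and> j \<in> G m then a else b)"

definition degree_mat :: "real mat \<Rightarrow> real mat" where
  "degree_mat K = mat_diag (dim_row K) (\<lambda>i. \<Sum>j<dim_col K. K $$ (i, j))"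

definition laplacian :: "real mat \<Rightarrow> real mat" where
  "laplacian K = degree_mat K - K"

(* Only real eigenvalues are collected, each with its algebraic multiplicity.  This is the
   full spectrum of an n by n matrix exactly when the multiset has size n, i.e. when the
   characteristic polynomial splits over the reals, as it does for symmetric matrices. *)
definition eigenvalues_mset :: "real mat \<Rightarrow> real multiset" where
  "eigenvalues_mset A = proots (char_poly A)"

end

theory Submission
  imports Defs
begin

text \<open>
  \<open>L\<close> is diagonalised by explicit left eigenvectors. Fix a representative \<open>r m\<close> of every group
  \<open>G m\<close>. A nonrepresentative \<open>k\<close> of \<open>G m\<close> gives \<open>e\<^sub>k - e\<^sub>r\<^sub>m\<close>, with eigenvalue
  \<open>a |G m| + b (N - |G m|)\<close>; a group \<open>m \<noteq> 1\<close> gives \<open>1\<^sub>G\<^sub>m / |G m| - 1\<^sub>G\<^sub>1 / |G 1|\<close>, with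
  eigenvalue \<open>b N\<close>; and the all-ones vector has eigenvalue \<open>0\<close>. A vector orthogonal to all of
  these is constant on each group, has the same mean on all groups and total sum zero, hence
  vanishes; so the \<open>N\<close> eigenvectors form a basis, even when eigenvalues coincide.
\<close>

section \<open>Spectrum from a basis of left eigenvectors\<close>

lemma sum_singleton_mset_const: "(\<Sum>x\<in>A. {#c#}) = replicate_mset (card A) c"
  by (induction A rule: infinite_finite_induct) auto

lemma proots_char_poly_mat_diag:
  fixes d :: "nat \<Rightarrow> 'a :: idom"
  shows "proots (char_poly (mat_diag n d)) = (\<Sum>k<n. {#d k#})"
proof -
  have "upper_triangular (mat_diag n d)"
    by (auto simp: mat_diag_def)
  then have "char_poly (mat_diag n d) = (\<Prod>c\<leftarrow>diag_mat (mat_diag n d). [:- c, 1:])"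
    by (intro char_poly_upper_triangular[where n = n]) auto
  also have "\<dots> = (\<Prod>c\<leftarrow>map d [0..<n]. [:- c, 1:])"
    by (intro arg_cong[where f = prod_list]) (simp add: diag_mat_def mat_diag_def)
  also have "\<dots> = (\<Prod>k<n. [:- d k, 1:])"
    by (simp add: prod.list_conv_set_nth atLeast0LessThan)
  finally show ?thesis
    by (simp add: proots_prod)
qed

text \<open>The \<open>w k\<close> are the rows of a matrix \<open>P\<close>. The assumption
  \<open>kernel\<close> makes \<open>P\<close> injective, hence invertible, and \<open>eigen\<close>
  says that \<open>P\<close> intertwines \<open>A\<close> with the diagonal matrix of
  \<open>d\<close>, so the two are similar. Repeated values of \<open>d\<close> need no separate
  treatment.\<close>

lemma proots_char_poly_left_eigenbasis:
  fixes A :: "'a :: field mat" and w :: "nat \<Rightarrow> nat \<Rightarrow> 'a"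
  assumes A: "A \<in> carrier_mat n n"
    and eigen: "\<And>k j. k < n \<Longrightarrow> j < n \<Longrightarrow> (\<Sum>i<n. w k i * A $$ (i, j)) = d k * w k j"
    and kernel: "\<And>x j. (\<And>k. k < n \<Longrightarrow> (\<Sum>i<n. w k i * x i) = 0) \<Longrightarrow> j < n \<Longrightarrow> x j = 0"
  shows "proots (char_poly A) = (\<Sum>k<n. {#d k#})"
proof -
  define P where "P = mat n n (\<lambda>(k, i). w k i)"
  have P: "P \<in> carrier_mat n n"
    by (simp add: P_def)
  have "det P \<noteq> 0"
  proof
    assume "det P = 0"
    then obtain v where v: "v \<in> carrier_vec n" "v \<noteq> 0\<^sub>v n" and Pv: "P *\<^sub>v v = 0\<^sub>v n"
      using det_0_iff_vec_prod_zero_field[OF P] by blast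
    have "(\<Sum>i<n. w k i * v $ i) = 0" if "k < n" for k
    proof -
      have "(P *\<^sub>v v) $ k = (\<Sum>i<n. w k i * v $ i)"
        using that v(1) by (simp add: P_def scalar_prod_def atLeast0LessThan)
      then show ?thesis
        using that by (simp add: Pv)
    qed
    then have "v $ j = 0" if "j < n" for j
      using kernel[of "\<lambda>i. v $ i"] that by blast
    then have "v = 0\<^sub>v n"
      using v(1) by (intro eq_vecI) auto
    with v(2) show False ..
  qed
  \<comment> \<open>The \<open>()\<close> only fills the extension slot of the record
    \<open>ring_mat\<close>.\<close>
  from det_non_zero_imp_unit[OF P this, of "()"] obtain Q
    where Q: "Q \<in> carrier_mat n n" and QP: "Q * P = 1\<^sub>m n" and PQ: "P * Q = 1\<^sub>m n"
    by (auto simp: Units_def ring_mat_def)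
  have "P * A = mat_diag n d * P"
    using A by (intro eq_matI)
      (auto simp: P_def mat_diag_mult_left[where n = n and nr = n] scalar_prod_def
        atLeast0LessThan eigen)
  then have "Q * (mat_diag n d * P) = (Q * P) * A"
    using A P Q by (simp add: assoc_mult_mat[where ?n\<^sub>1 = n])
  also have "\<dots> = A"
    using A by (simp add: QP)
  finally have "A = Q * mat_diag n d * P"
    using P Q by (simp add: assoc_mult_mat[OF Q mat_diag_dim P])
  then have "similar_mat A (mat_diag n d)"
    using A P Q PQ QP by (intro similar_matI[where P = Q and Q = P and n = n]) auto
  then show ?thesis
    by (simp add: char_poly_similar proots_char_poly_mat_diag)
qed

section \<open>The Laplacian of a group kernel\<close>

lemma laplacian_carrier: "K \<in> carrier_mat n n \<Longrightarrow> laplacian K \<in> carrier_mat n n"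
  by (auto simp: laplacian_def degree_mat_def)

lemma group_kernel_carrier: "group_kernel M G N a b \<in> carrier_mat N N"
  by (simp add: group_kernel_def)

text \<open>For \<open>j\<close> in \<open>G m\<close>, column \<open>j\<close> of the kernel is
  \<open>b\<close> plus \<open>a - b\<close> times the indicator of \<open>G m\<close>. The product
  thus sees \<open>w\<close> only through its value at \<open>j\<close>, its sum over
  \<open>G m\<close> and its total, and checking an eigenvector reduces to computing these two
  sums.\<close>

lemma laplacian_group_kernel_left_mult:
  assumes disj: "disjoint_family_on G {1..M}"
    and m: "m \<in> {1..M}" and sub: "G m \<subseteq> {..<N}" and j: "j \<in> G m"
  shows "(\<Sum>i<N. w i * laplacian (group_kernel M G N a b) $$ (i, j)) =
    (a * real (card (G m)) + b * (real N - real (card (G m)))) * w j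
      - (a - b) * (\<Sum>i\<in>G m. w i) - b * (\<Sum>i<N. w i)"
proof -
  let ?K = "group_kernel M G N a b"
  have jN: "j < N"
    using sub j by auto
  have "j \<in> G l \<longleftrightarrow> l = m" if "l \<in> {1..M}" for l
    using disjoint_family_onD[OF disj that m] j by blast
  then have same: "(\<exists>l\<in>{1..M}. i \<in> G l \<and> j \<in> G l) \<longleftrightarrow> i \<in> G m" for i
    using m by blast
  \<comment> \<open>The column enters the left product, the row enters the degree; by symmetry of
    the kernel they agree.\<close>
  have K: "?K $$ (i, j) = b + (a - b) * of_bool (i \<in> G m)"
    and K': "?K $$ (j, i) = b + (a - b) * of_bool (i \<in> G m)" if "i < N" for i
    using that jN same[of i] by (simp_all only: group_kernel_def index_mat split conj_commute) auto
  have restrict: "(\<Sum>i<N. f i * of_bool (i \<in> G m)) = (\<Sum>i\<in>G m. f i)" for f :: "nat \<Rightarrow> real"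
    using sub by (simp add: Int_absorb1)
  have deg: "(\<Sum>i<N. ?K $$ (j, i)) = a * real (card (G m)) + b * (real N - real (card (G m)))"
  proof -
    have "(\<Sum>i<N. ?K $$ (j, i)) = (\<Sum>i<N. b) + (\<Sum>i<N. (a - b) * of_bool (i \<in> G m))"
      by (simp add: K' sum.distrib)
    then show ?thesis
      by (simp only: restrict) (simp add: algebra_simps)
  qed
  have "(\<Sum>i<N. w i * laplacian ?K $$ (i, j)) =
      (\<Sum>i<N. (if i = j then w j * (\<Sum>i<N. ?K $$ (j, i)) else 0) - w i * ?K $$ (i, j))"
    using jN group_kernel_carrier[of M G N a b]
    by (intro sum.cong) (auto simp: laplacian_def degree_mat_def mat_diag_def algebra_simps)
  also have "\<dots> = w j * (\<Sum>i<N. ?K $$ (j, i)) - (\<Sum>i<N. w i * ?K $$ (i, j))"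
    using jN by (simp add: sum_subtractf)
  also have "(\<Sum>i<N. w i * ?K $$ (i, j)) =
      b * (\<Sum>i<N. w i) + (a - b) * (\<Sum>i<N. w i * of_bool (i \<in> G m))"
    unfolding sum_distrib_left sum.distrib[symmetric]
    by (intro sum.cong) (simp_all add: K algebra_simps)
  finally show ?thesis
    by (simp only: deg restrict) (simp add: algebra_simps)
qed

theorem proposition3p1:
  fixes N M :: nat and G :: "nat \<Rightarrow> nat set" and a b :: real and K L :: "real mat"
  assumes "N \<ge> 1"
    and "disjoint_family_on G {1..M}"
    and "\<And>m. m \<in> {1..M} \<Longrightarrow> G m \<noteq> {}"
    and "(\<Union>m\<in>{1..M}. G m) = {..<N}"
    and "K = group_kernel M G N a b"
    and "L = laplacian K"
  shows "eigenvalues_mset L =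
      (\<Sum>m = 1..M. replicate_mset (card (G m) - 1)
         (a * real (card (G m)) + b * (real N - real (card (G m)))))
      + replicate_mset 1 0
      + replicate_mset (M - 1) (b * real N)"
proof -

  \<comment> \<open>Groups and representatives\<close>
  note disj = assms(2) and cover = assms(4)
  let ?I = "{1..M}"
  define g where "g m = real (card (G m))" for m
  define ev where "ev m = a * g m + b * (real N - g m)" for m
  have sub: "G m \<subseteq> {..<N}" if "m \<in> ?I" for m
    using cover that by blast
  have fin: "finite (G m)" if "m \<in> ?I" for m
    using sub[OF that] finite_subset by blast
  have g_pos: "g m > 0" if "m \<in> ?I" for m
    using fin[OF that] assms(3)[OF that] by (simp add: g_def card_gt_0_iff)
  have uniq: "l = m" if "i \<in> G l" "i \<in> G m" "l \<in> ?I" "m \<in> ?I" for i l m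
    using disj that unfolding disjoint_family_on_def by blast
  \<comment> \<open>Some group must contain index 0, so \<open>M \<ge> 1\<close> and group 1 can
    serve as the reference group.\<close>
  have "0 \<in> {..<N}"
    using assms(1) by simp
  then have one: "1 \<in> ?I"
    unfolding cover[symmetric] by auto
  have "\<forall>i\<in>{..<N}. \<exists>m. m \<in> ?I \<and> i \<in> G m"
    using cover by blast
  \<comment> \<open>\<open>c i\<close> is the group of \<open>i\<close>; with \<open>r\<close>
    below, \<open>k\<close> is a representative exactly when \<open>k = r (c k)\<close>.\<close>
  from bchoice[OF this] obtain c where "\<forall>i\<in>{..<N}. c i \<in> ?I \<and> i \<in> G (c i)" ..
  then have c: "c i \<in> ?I" "i \<in> G (c i)" if "i < N" for i
    using that by auto
  have "\<forall>m\<in>?I. \<exists>i. i \<in> G m"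
    using assms(3) by blast
  from bchoice[OF this] obtain r where "\<forall>m\<in>?I. r m \<in> G m" ..
  then have r: "r m \<in> G m" if "m \<in> ?I" for m
    using that by blast
  have G_iff: "i \<in> G m \<longleftrightarrow> c i = m" if "i < N" "m \<in> ?I" for i m
    using c uniq that by blast
  have rN: "r m < N" if "m \<in> ?I" for m
    using r sub that by blast
  have cr: "c (r m) = m" if "m \<in> ?I" for m
    using G_iff r rN that by blast
  have G_sum: "(\<Sum>i\<in>G m. f i) = (\<Sum>i<N. of_bool (c i = m) * f i)" if "m \<in> ?I"
    for m and f :: "nat \<Rightarrow> real"
  proof -
    have "{..<N} \<inter> {i. c i = m} = G m"
      using G_iff[OF _ that] sub[OF that] by auto
    then show ?thesis
      by (simp add: sum_of_bool_mult_eq)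
  qed

  \<comment> \<open>Eigenvectors and their pairings\<close>
  define mean where "mean m f = (\<Sum>i\<in>G m. f i) / g m" for m and f :: "nat \<Rightarrow> real"
  \<comment> \<open>Each index \<open>k < N\<close> labels one eigenvector: a nonrepresentative its
    difference vector, \<open>r 1\<close> the all-ones vector, any other \<open>r m\<close> the
    comparison of groups \<open>m\<close> and 1.\<close>
  define d where "d k = (if k \<noteq> r (c k) then ev (c k) else if c k = 1 then 0 else b * real N)" for k
  define w where "w k i =
    (if k \<noteq> r (c k) then of_bool (i = k) - of_bool (i = r (c k))
     else if c k = 1 then 1
     else of_bool (c i = c k) / g (c k) - of_bool (c i = 1) / g 1)" for k i
  \<comment> \<open>This pairing is used twice: with indicators and the constant 1 for the
    eigenvector equation, and with an arbitrary \<open>x\<close> for the kernel.\<close>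
  have w_sum: "(\<Sum>i<N. w k i * f i) =
      (if k \<noteq> r (c k) then f k - f (r (c k))
       else if c k = 1 then (\<Sum>i<N. f i)
       else mean (c k) f - mean 1 f)" if "k < N" for k and f :: "nat \<Rightarrow> real"
  proof -
    have single: "(\<Sum>i<N. of_bool (i = l) * f i) = f l" if "l < N" for l
    proof -
      have "{..<N} \<inter> {i. i = l} = {l}"
        using that by auto
      then show ?thesis
        by (simp add: sum_of_bool_mult_eq)
    qed
    consider "k \<noteq> r (c k)" | "k = r (c k)" "c k = 1" | "k = r (c k)" "c k \<noteq> 1"
      by blast
    then show ?thesis
    proof cases
      case 1
      then show ?thesis
        using single[OF that] single[OF rN[OF c(1)[OF that]]]
        by (simp add: w_def left_diff_distrib sum_subtractf)
    next
      case 2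
      then show ?thesis
        by (simp add: w_def)
    next
      case 3
      then have "w k i * f i =
          of_bool (c i = c k) * f i / g (c k) - of_bool (c i = 1) * f i / g 1" for i
        by (simp add: w_def left_diff_distrib)
      with 3 show ?thesis
        by (simp only: mean_def G_sum[OF one] G_sum[OF c(1)[OF that]] sum_subtractf
            sum_divide_distrib) simp
    qed
  qed
  have mean_const: "mean m (\<lambda>_. t) = t" if "m \<in> ?I" for m t
    using g_pos[OF that] by (simp add: mean_def g_def)
  have mean_ind: "mean m (\<lambda>i. of_bool (i \<in> G l)) = of_bool (l = m)" if "l \<in> ?I" "m \<in> ?I" for l m
  proof -
    have "mean m (\<lambda>i. of_bool (i \<in> G l)) = mean m (\<lambda>_. of_bool (l = m))"
      unfolding mean_def using uniq that
      by (intro arg_cong2[where f = "(/)"] sum.cong) auto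
    then show ?thesis
      using mean_const that by simp
  qed

  \<comment> \<open>Eigenvector equations\<close>
  have eigen: "(\<Sum>i<N. w k i * L $$ (i, j)) = d k * w k j" if kj: "k < N" "j < N" for k j
  proof -
    let ?m = "c j"
    have m: "?m \<in> ?I" and j: "j \<in> G ?m"
      using c kj by auto
    note k = c(1)[OF kj(1)]
    have "{..<N} \<inter> G ?m = G ?m"
      using sub[OF m] by blast
    then have "(\<Sum>i\<in>G ?m. w k i) = (\<Sum>i<N. w k i * of_bool (i \<in> G ?m))"
      by simp
    \<comment> \<open>The indicator and the factor 1 bring both sums into the form evaluated by
      \<open>w_sum\<close>.\<close>
    then have "(\<Sum>i<N. w k i * L $$ (i, j)) = ev ?m * w k j
        - (a - b) * (\<Sum>i<N. w k i * of_bool (i \<in> G ?m)) - b * (\<Sum>i<N. w k i * 1)"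
      unfolding assms(5,6) laplacian_group_kernel_left_mult[OF disj m sub[OF m] j]
      by (simp add: ev_def g_def)
    also have "\<dots> = d k * w k j"
    proof -
      consider "k \<noteq> r (c k)" | "k = r (c k)" "c k = 1" | "k = r (c k)" "c k \<noteq> 1"
        by blast
      then show ?thesis
      proof cases
        \<comment> \<open>\<open>k\<close> and \<open>r (c k)\<close> lie in the same group, so both
          sums vanish; \<open>w k j\<close> is nonzero only if \<open>c j = c k\<close>, where
          \<open>ev\<close> is the right eigenvalue.\<close>
        case 1
        then show ?thesis
          unfolding w_sum[OF kj(1)] using G_iff[OF kj(1) m] G_iff[OF rN[OF k] m] cr[OF k]
          by (auto simp: d_def w_def)
      next
        \<comment> \<open>The factors cancel:
          \<open>ev m - (a - b) * g m - b * N = 0\<close>.\<close>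
        case 2
        have "(\<Sum>i<N. of_bool (i \<in> G ?m)) = g ?m"
          using sub[OF m] by (simp add: g_def Int_absorb1)
        with 2 show ?thesis
          unfolding w_sum[OF kj(1)] by (simp add: d_def w_def ev_def algebra_simps)
      next
        \<comment> \<open>The total is 0 and the sum over the group of \<open>j\<close> is
          \<open>g (c j) * w k j\<close>, since \<open>w k\<close> is constant on groups; what
          remains is \<open>ev m - (a - b) * g m = b * N\<close>.\<close>
        case 3
        have dk: "d k = b * real N"
          using 3 by (simp add: d_def)
        have "w k j = of_bool (?m = c k) / g (c k) - of_bool (?m = 1) / g 1"
          unfolding w_def using 3 by simp
        then have weight: "of_bool (?m = c k) - of_bool (?m = 1) = g ?m * w k j"
          using g_pos[OF m] 3(2) by (cases "?m = c k"; cases "?m = 1") simp_all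
        have "(\<Sum>i<N. w k i * of_bool (i \<in> G ?m)) = g ?m * w k j"
          unfolding w_sum[OF kj(1)] mean_ind[OF m k] mean_ind[OF m one] weight using 3 by simp
        moreover have "(\<Sum>i<N. w k i * 1) = 0"
          unfolding w_sum[OF kj(1)] mean_const[OF k] mean_const[OF one] using 3 by simp
        ultimately show ?thesis
          by (simp only: dk ev_def) (simp add: algebra_simps)
      qed
    qed
    finally show ?thesis .
  qed

  \<comment> \<open>Vanishing of vectors orthogonal to all eigenvectors\<close>
  have kernel: "x j = 0" if orth: "\<And>k. k < N \<Longrightarrow> (\<Sum>i<N. w k i * x i) = 0" and j: "j < N"
    for x :: "nat \<Rightarrow> real" and j
  proof -
    have const: "x i = x (r (c i))" if "i < N" for i
      using orth[OF that] w_sum[OF that, of x] by (cases "i = r (c i)") auto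
    have mean_rep: "mean m x = x (r m)" if "m \<in> ?I" for m
    proof -
      have "x i = x (r m)" if "i \<in> G m" for i
        using const[of i] G_iff[of i m] sub[of m] \<open>m \<in> ?I\<close> that by blast
      then have "mean m x = mean m (\<lambda>_. x (r m))"
        unfolding mean_def by (intro arg_cong2[where f = "(/)"] sum.cong) auto
      then show ?thesis
        using mean_const that by simp
    qed
    \<comment> \<open>Orthogonality to the vector labelled \<open>r m\<close> equates the means over
      groups \<open>m\<close> and 1.\<close>
    have rep: "x (r m) = x (r 1)" if "m \<in> ?I" for m
      using orth[OF rN[OF that]] w_sum[OF rN[OF that], of x] mean_rep[OF that] mean_rep[OF one]
        cr[OF that] by (cases "m = 1") auto
    have all: "x i = x (r 1)" if "i < N" for i
      using const[OF that] rep[OF c(1)[OF that]] by (rule trans)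
    have "(\<Sum>i<N. x i) = 0"
      using orth[OF rN[OF one]] w_sum[OF rN[OF one], of x] cr[OF one] by simp
    moreover have "(\<Sum>i<N. x i) = (\<Sum>i<N. x (r 1))"
      using all by (intro sum.cong) auto
    ultimately show ?thesis
      using all[OF j] assms(1) by simp
  qed

  \<comment> \<open>Counting multiplicities\<close>
  have "L \<in> carrier_mat N N"
    unfolding assms(5,6) by (intro laplacian_carrier group_kernel_carrier)
  then have "eigenvalues_mset L = (\<Sum>k<N. {#d k#})"
    unfolding eigenvalues_mset_def using eigen kernel by (rule proots_char_poly_left_eigenbasis)
  also have "\<dots> = (\<Sum>m\<in>?I. \<Sum>k\<in>G m. {#d k#})"
    unfolding cover[symmetric] using fin uniq by (intro sum.UNION_disjoint) auto
  also have "\<dots> = (\<Sum>m\<in>?I. replicate_mset (card (G m) - 1) (ev m) + {#d (r m)#})"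
  proof (rule sum.cong)
    fix m assume m: "m \<in> ?I"
    \<comment> \<open>Splitting off the representative leaves \<open>card (G m) - 1\<close> copies
      of \<open>ev m\<close>.\<close>
    have "(\<Sum>k\<in>G m. {#d k#}) = {#d (r m)#} + (\<Sum>k\<in>G m - {r m}. {#d k#})"
      using fin[OF m] r[OF m] by (rule sum.remove)
    also have "(\<Sum>k\<in>G m - {r m}. {#d k#}) = (\<Sum>k\<in>G m - {r m}. {#ev m#})"
      using G_iff[OF _ m] sub[OF m] by (intro sum.cong) (auto simp: d_def subset_iff)
    finally show "(\<Sum>k\<in>G m. {#d k#}) = replicate_mset (card (G m) - 1) (ev m) + {#d (r m)#}"
      using fin[OF m] r[OF m] by (simp add: sum_singleton_mset_const)
  qed simp
  also have "\<dots> = (\<Sum>m\<in>?I. replicate_mset (card (G m) - 1) (ev m)) + (\<Sum>m\<in>?I. {#d (r m)#})"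
    by (rule sum.distrib)
  \<comment> \<open>Among the \<open>M\<close> representatives, that of group 1 carries 0 and the
    others carry \<open>b * N\<close>.\<close>
  also have "(\<Sum>m\<in>?I. {#d (r m)#}) = {#d (r 1)#} + (\<Sum>m\<in>?I - {1}. {#d (r m)#})"
    using one by (intro sum.remove) auto
  also have "(\<Sum>m\<in>?I - {1}. {#d (r m)#}) = (\<Sum>m\<in>?I - {1}. {#b * real N#})"
    using cr by (intro sum.cong) (auto simp: d_def)
  also have "\<dots> = replicate_mset (M - 1) (b * real N)"
    using one by (simp add: sum_singleton_mset_const)
  also have "d (r 1) = 0"
    using cr[OF one] by (simp add: d_def)
  finally show ?thesis
    by (simp add: ev_def g_def add.assoc)
qed

end
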